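(* For any knot diagram $D$, $b(D)\le c(D)$, and equality holds if and only if $D$ is an alternating knot diagram. Furthermore, $b(K)\le c(K)$ for any knot $K$.
   Context: A knot is the isotopy class of a tame oriented embedded circle in $S^3$. A knot diagram $D$ is a regular planar projection of a representative of the knot, with finitely many transverse double points (crossings) and over/under information at each; each crossing $x$ corresponds to two points of $D$, an overcrossing $x_+$ and an undercrossing $x_-$. $D$ is a diagram of $K$ if it represents $K$. A diagram is alternating if overcrossings and undercrossings alternate as one travels along it (a diagram without crossings counts as alternating). $c(D)$ is the number of crossings of $D$. Definition of $b(D)$: if $c(D)=0$, then $b(D)=0$. If $c(D)\ge 1$, $b(D)$ is the unique positive integer $k$ for which there are $2k$ points $s_1,f_1,s_2,f_2,\dots,s_k,f_k$ of $D$, none of them an overcrossing or undercrossing, met in this cyclic order when $D$ is traversed once along its orientation, such that for each $i$ (indices mod $k$) the closed arc $[s_i,f_i]$ of $D$ contains at least one overcrossing and no undercrossing (an overpass), and the closed arc $[f_i,s_{i+1}]$ contains at least one undercrossing and no overcrossing (an underpass). For a knot $K$, $c(K)=\min\{c(D)\mid D\text{ is a diagram of }K\}$ and $b(K)=\min\{b(D)\mid D\text{ is a diagram of }K\}$. *)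

theory Defs
  imports "HOL-Analysis.Analysis"
begin

text \<open>
  Space is \<open>(real ^ 2) \<times> real\<close>, so that projecting to the plane is \<^const>\<open>fst\<close> and the height is
  \<^const>\<open>snd\<close>; the 3-sphere is the unit sphere of \<open>((real ^ 2) \<times> real) \<times> real\<close>, and
  \<open>stereo\<close> (inverse stereographic projection) identifies space with the 3-sphere minus
  its north pole \<open>(0, 1)\<close>.

  An oriented circle is given by a loop parametrised by \<open>{0..1}\<close>, traversed in the direction of
  increasing parameter. A point of the circle is a parameter in \<open>{0..<1}\<close>; \<^const>\<open>frac\<close> wraps an
  arbitrary real number to such a parameter, so that the reals cover the circle.
\<close>

type_synonym space = "(real ^ 2) \<times> real"

abbreviation S3 :: "(space \<times> real) set" where
  "S3 \<equiv> sphere 0 1"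

definition stereo :: "space \<Rightarrow> space \<times> real" where
  "stereo x = ((2 / ((norm x)\<^sup>2 + 1)) *\<^sub>R x, ((norm x)\<^sup>2 - 1) / ((norm x)\<^sup>2 + 1))"

subsection \<open>Knots\<close>

definition embedded_circle :: "(real \<Rightarrow> space \<times> real) \<Rightarrow> bool" where
  "embedded_circle g \<longleftrightarrow>
     simple_path g \<and> pathfinish g = pathstart g \<and> path_image g \<subseteq> S3"

text \<open>Tame: some homeomorphism of the 3-sphere makes the circle polygonal.\<close>

definition tame :: "(real \<Rightarrow> space \<times> real) \<Rightarrow> bool" where
  "tame g \<longleftrightarrow>
     (\<exists>h h' E. homeomorphism S3 S3 h h' \<and> finite E \<and>
        h ` path_image g = stereo ` (\<Union>(a, b)\<in>E. closed_segment a b))"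

text \<open>
  Isotopy means ambient isotopy. The reparametrisation \<open>\<phi>\<close> is (the lift to the reals of) an
  orientation preserving homeomorphism of the circle: knots are oriented, but not parametrised.
\<close>

definition isotopic :: "(real \<Rightarrow> space \<times> real) \<Rightarrow> (real \<Rightarrow> space \<times> real) \<Rightarrow> bool" where
  "isotopic g g' \<longleftrightarrow>
     (\<exists>H \<phi>. continuous_on ({0..1} \<times> S3) (\<lambda>(t, x). H t x) \<and>
        (\<forall>t\<in>{0..1::real}. \<exists>k. homeomorphism S3 S3 (H t) k) \<and>
        (\<forall>x\<in>S3. H 0 x = x) \<and>
        continuous_on UNIV \<phi> \<and> strict_mono \<phi> \<and> (\<forall>t. \<phi> (t + 1) = \<phi> t + 1) \<and>
        (\<forall>t. H 1 (g (frac t)) = g' (frac (\<phi> t))))"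

definition tame_circles :: "(real \<Rightarrow> space \<times> real) set" where
  "tame_circles = {g. embedded_circle g \<and> tame g}"

definition knot :: "(real \<Rightarrow> space \<times> real) set \<Rightarrow> bool" where
  "knot K \<longleftrightarrow>
     K \<in> tame_circles // {(g, g'). g \<in> tame_circles \<and> g' \<in> tame_circles \<and> isotopic g g'}"

subsection \<open>Diagrams\<close>

text \<open>
  A diagram consists of a closed plane curve and of the set of those parameters that
  are overcrossings.
\<close>

record diagram =
  curve :: "real \<Rightarrow> real ^ 2"
  over :: "real set"

definition crossings :: "(real \<Rightarrow> real ^ 2) \<Rightarrow> (real ^ 2) set" where
  "crossings \<gamma> = {P. \<exists>s\<in>{0..<1}. \<exists>t\<in>{0..<1}. s \<noteq> t \<and> \<gamma> s = P \<and> \<gamma> t = P}"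

definition crossing_params :: "(real \<Rightarrow> real ^ 2) \<Rightarrow> real set" where
  "crossing_params \<gamma> = {t \<in> {0..<1}. \<gamma> t \<in> crossings \<gamma>}"

text \<open>
  Transversality is stated topologically, since curves need be neither smooth nor polygonal:
  in a suitable local chart \<open>h\<close> of the plane the strand through \<open>s\<close> runs along the first
  coordinate axis, and the strand through \<open>t\<close> along the second one. (For a curve
  that is injective near \<open>s\<close> and near \<open>t\<close>, as a curve with finitely many double points
  is, each strand then passes through the origin from one side to the other.)
\<close>

definition transverse_at :: "(real \<Rightarrow> real ^ 2) \<Rightarrow> real \<Rightarrow> real \<Rightarrow> bool" where
  "transverse_at \<gamma> s t \<longleftrightarrow>
     (\<exists>U (V :: (real ^ 2) set) h h' \<epsilon>. open U \<and> open V \<and> homeomorphism U V h h' \<and>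
        \<gamma> s \<in> U \<and> h (\<gamma> s) = 0 \<and> \<epsilon> > 0 \<and>
        (\<forall>u. \<bar>u - s\<bar> < \<epsilon> \<longrightarrow> \<gamma> (frac u) \<in> U \<and> h (\<gamma> (frac u)) $ 2 = 0) \<and>
        (\<forall>u. \<bar>u - t\<bar> < \<epsilon> \<longrightarrow> \<gamma> (frac u) \<in> U \<and> h (\<gamma> (frac u)) $ 1 = 0))"

definition regular :: "(real \<Rightarrow> real ^ 2) \<Rightarrow> bool" where
  "regular \<gamma> \<longleftrightarrow>
     path \<gamma> \<and> pathfinish \<gamma> = pathstart \<gamma> \<and> finite (crossings \<gamma>) \<and>
     (\<forall>P\<in>crossings \<gamma>. card {t \<in> {0..<1}. \<gamma> t = P} = 2) \<and>
     (\<forall>s\<in>{0..<1}. \<forall>t\<in>{0..<1}. s \<noteq> t \<and> \<gamma> s = \<gamma> t \<longrightarrow> transverse_at \<gamma> s t)"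

definition projects_to :: "(real \<Rightarrow> space) \<Rightarrow> diagram \<Rightarrow> bool" where
  "projects_to g D \<longleftrightarrow>
     (\<forall>t\<in>{0..1}. curve D t = fst (g t)) \<and> regular (curve D) \<and>
     over D = {s \<in> {0..<1}. \<exists>t\<in>{0..<1}. s \<noteq> t \<and> curve D s = curve D t \<and> snd (g t) < snd (g s)}"

definition diagram_of :: "diagram \<Rightarrow> (real \<Rightarrow> space \<times> real) set \<Rightarrow> bool" where
  "diagram_of D K \<longleftrightarrow> (\<exists>g. stereo \<circ> g \<in> K \<and> projects_to g D)"

definition knot_diagram :: "diagram \<Rightarrow> bool" where
  "knot_diagram D \<longleftrightarrow> (\<exists>K. knot K \<and> diagram_of D K)"

definition under :: "diagram \<Rightarrow> real set" where
  "under D = crossing_params (curve D) - over D"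

definition alternating :: "diagram \<Rightarrow> bool" where
  "alternating D \<longleftrightarrow>
     (\<forall>s t. s < t \<and> frac s \<in> crossing_params (curve D) \<and> frac t \<in> crossing_params (curve D) \<and>
        (\<forall>u. s < u \<and> u < t \<longrightarrow> frac u \<notin> crossing_params (curve D)) \<longrightarrow>
        (frac s \<in> over D \<longleftrightarrow> frac t \<in> under D))"

subsection \<open>Crossing number and bridge number\<close>

definition c_diagram :: "diagram \<Rightarrow> nat" where
  "c_diagram D = card (crossings (curve D))"

text \<open>For \<open>s \<le> f\<close>, the closed arc from \<open>s\<close> to \<open>f\<close> consists of the parameters \<open>frac ` {s..f}\<close>.\<close>

definition overpass :: "diagram \<Rightarrow> real \<Rightarrow> real \<Rightarrow> bool" where
  "overpass D s f \<longleftrightarrow> frac ` {s..f} \<inter> over D \<noteq> {} \<and> frac ` {s..f} \<inter> under D = {}"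

definition underpass :: "diagram \<Rightarrow> real \<Rightarrow> real \<Rightarrow> bool" where
  "underpass D f s \<longleftrightarrow> frac ` {f..s} \<inter> under D \<noteq> {} \<and> frac ` {f..s} \<inter> over D = {}"

text \<open>
  The points are \<open>s 0, f 0, \<dots>, s (k - 1), f (k - 1)\<close>, and \<open>s k = s 0 + 1\<close> is the point
  \<open>s 0\<close> again after one full turn.
\<close>

definition bridge_decomposition :: "diagram \<Rightarrow> nat \<Rightarrow> bool" where
  "bridge_decomposition D k \<longleftrightarrow>
     k \<ge> 1 \<and>
     (\<exists>s f :: nat \<Rightarrow> real.
        s k = s 0 + 1 \<and>
        (\<forall>i<k. s i < f i \<and> f i < s (Suc i) \<and>
           frac (s i) \<notin> crossing_params (curve D) \<and> frac (f i) \<notin> crossing_params (curve D) \<and>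
           overpass D (s i) (f i) \<and> underpass D (f i) (s (Suc i))))"

definition b_diagram :: "diagram \<Rightarrow> nat" where
  "b_diagram D = (if c_diagram D = 0 then 0 else (THE k. bridge_decomposition D k))"

text \<open>
  On \<^typ>\<open>nat\<close>, \<^const>\<open>Inf\<close> of a nonempty set is its minimum. The sets below are
  nonempty for every knot \<open>K\<close>, because a tame knot has a regular projection.
\<close>

definition c_knot :: "(real \<Rightarrow> space \<times> real) set \<Rightarrow> nat" where
  "c_knot K = Inf {c_diagram D | D. diagram_of D K}"

definition b_knot :: "(real \<Rightarrow> space \<times> real) set \<Rightarrow> nat" where
  "b_knot K = Inf {b_diagram D | D. diagram_of D K}"

end

theory Submission
  imports Defs
begin

text \<open>
  Lift over- and undercrossings to periodic subsets of the real line. In a bridge decomposition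
  the \<open>i\<close>-th underpass starts with the first undercrossing that follows the \<open>i\<close>-th overpass. Hence
  the number of bridges is the size of the image of the map that sends each overcrossing to the first
  undercrossing after it. There are as many overcrossings as crossings, so \<open>b(D) \<le> c(D)\<close>, with
  equality iff this map is injective; two overcrossings have the same image iff no undercrossing
  separates them on one of the two arcs between them, and by counting injectivity also means that
  every undercrossing is directly preceded by an overcrossing.
\<close>

subsection \<open>Periodic sets of reals\<close>

lemma frac_eq_iff_diff_Ints: "frac x = frac y \<longleftrightarrow> (\<exists>m::int. x = y + of_int m)" for x y :: real
proof
  assume "frac x = frac y"
  then have "x = y + of_int (\<lfloor>x\<rfloor> - \<lfloor>y\<rfloor>)"
    by (simp add: frac_def)
  then show "\<exists>m::int. x = y + of_int m" ..
qed (auto simp: frac_def)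

lemma frac_add_of_int [simp]: "frac (x + of_int m) = frac x" for x :: real
  by (simp add: frac_def)

lemma frac_inj_of_less_1:
  fixes x y :: real
  assumes "frac x = frac y" "\<bar>x - y\<bar> < 1"
  shows "x = y"
proof -
  obtain m :: int where m: "x = y + of_int m"
    using assms(1) unfolding frac_eq_iff_diff_Ints by blast
  with assms(2) have "m = 0" by simp
  with m show ?thesis by simp
qed

text \<open>Restricting to one period makes the set finite, as \<^const>\<open>Min\<close> requires.\<close>

definition next_in :: "real set \<Rightarrow> real \<Rightarrow> real" where
  "next_in X x = Min {t. x < t \<and> t \<le> x + 1 \<and> frac t \<in> X}"

text \<open>\<open>X\<close> stands for a finite nonempty set of points of the circle. Its lift, all
  \<open>t\<close> with \<open>frac t\<close> in \<open>X\<close>, has period 1, so the order along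
  the curve becomes the order of the reals.\<close>

locale periodic_set =
  fixes X :: "real set"
  assumes fin: "finite X" and ne: "X \<noteq> {}" and sub: "X \<subseteq> {0..<1}"
begin

lemma finite_period: "finite {t. x < t \<and> t \<le> x + 1 \<and> frac t \<in> X}"
proof -
  have "inj_on frac {x<..x+1}"
    by (rule inj_onI, rule frac_inj_of_less_1) auto
  from finite_vimage_IntI[OF fin this]
  show ?thesis
    by (rule finite_subset[rotated]) auto
qed

lemma period_nonempty: "{t. x < t \<and> t \<le> x + 1 \<and> frac t \<in> X} \<noteq> {}"
proof -
  obtain q where q: "q \<in> X" using ne by blast
  then have "frac q = q" using sub by (auto simp: frac_eq)
  \<comment> \<open>This integer translate of \<open>q\<close> is the one lying in the half-open
    period from \<open>x\<close> to \<open>x + 1\<close>.\<close>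
  then have "frac (q + of_int (\<lfloor>x - q\<rfloor> + 1)) \<in> X" using q by (simp only: frac_add_of_int)
  moreover have "x < q + of_int (\<lfloor>x - q\<rfloor> + 1)" "q + of_int (\<lfloor>x - q\<rfloor> + 1) \<le> x + 1"
    by linarith+
  ultimately show ?thesis by blast
qed

lemma next_in_greater: "x < next_in X x"
  and next_in_le_add_1: "next_in X x \<le> x + 1"
  and frac_next_in: "frac (next_in X x) \<in> X"
  using Min_in[OF finite_period period_nonempty, of x] unfolding next_in_def by auto

lemma next_in_le:
  assumes "x < y" "frac y \<in> X"
  shows "next_in X x \<le> y"
proof (cases "y \<le> x + 1")
  case True
  then show ?thesis
    unfolding next_in_def using assms by (intro Min_le[OF finite_period]) auto
next
  case False
  then show ?thesis using next_in_le_add_1[of x] by linarith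
qed

lemma next_in_eqI:
  assumes "x < y" "frac y \<in> X" "\<And>z. x < z \<Longrightarrow> z < y \<Longrightarrow> frac z \<notin> X"
  shows "next_in X x = y"
proof (rule antisym)
  show "next_in X x \<le> y" using assms(1,2) by (rule next_in_le)
  show "y \<le> next_in X x"
    using assms(3)[OF next_in_greater] frac_next_in not_le by blast
qed

lemma next_in_eq:
  assumes "x \<le> y" "\<And>z. x < z \<Longrightarrow> z \<le> y \<Longrightarrow> frac z \<notin> X"
  shows "next_in X x = next_in X y"
proof (rule next_in_eqI)
  fix z assume "x < z" "z < next_in X y"
  then show "frac z \<notin> X"
    using assms(2)[of z] next_in_le[of y z] by (cases "z \<le> y") auto
qed (use assms(1) next_in_greater[of y] frac_next_in in auto)

text \<open>Equivariance under integer translations: this is what lets \<open>next_in X\<close>,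
  followed by \<open>frac\<close>, descend to a map on the circle.\<close>

lemma next_in_add_of_int: "next_in X (x + of_int m) = next_in X x + of_int m"
proof (rule next_in_eqI)
  fix z assume "x + of_int m < z" "z < next_in X x + of_int m"
  then show "frac z \<notin> X"
    using next_in_le[of x "z + of_int (- m)"] by (auto simp del: of_int_minus)
qed (use next_in_greater[of x] frac_next_in[of x] in auto)

lemma next_in_frac: "frac (next_in X (frac x)) = frac (next_in X x)"
  using next_in_add_of_int[of "frac x" "\<lfloor>x\<rfloor>"] frac_add_of_int[of "next_in X (frac x)" "\<lfloor>x\<rfloor>"]
  by (simp add: frac_def)

text \<open>By equivariance, the distance to the next point takes only the finitely many values
  attained on \<open>X\<close>, so it has a positive minimum. Half of it gives the strict
  inequality, and provides room to cut just before a crossing.\<close>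

lemma gap:
  obtains \<delta> where "\<delta> > 0" "\<And>x y. frac x \<in> X \<Longrightarrow> frac y \<in> X \<Longrightarrow> x < y \<Longrightarrow> x + \<delta> < y"
proof
  define d where "d = Min ((\<lambda>p. next_in X p - p) ` X)"
  have "d > 0"
    unfolding d_def using fin ne next_in_greater by (subst Min_gr_iff) auto
  then show "d / 2 > 0" by simp
  fix x y assume *: "frac x \<in> X" "frac y \<in> X" "x < y"
  have "d \<le> next_in X (frac x) - frac x"
    unfolding d_def using fin * by (intro Min_le) auto
  also have "\<dots> = next_in X x - x"
    using next_in_add_of_int[of "frac x" "\<lfloor>x\<rfloor>"] by (simp add: frac_def)
  also have "\<dots> \<le> y - x" using next_in_le * by simp
  finally show "x + d / 2 < y" using \<open>d > 0\<close> by linarith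
qed

end

subsection \<open>Counting bridges\<close>

text \<open>The combinatorial content of a knot diagram with at least one crossing; the counting
  below refers to no topology.\<close>

locale crossing_diagram =
  fixes D :: diagram
  assumes over_fin: "finite (over D)" and over_ne: "over D \<noteq> {}"
    and under_fin: "finite (under D)" and under_ne: "under D \<noteq> {}"
    and over_sub: "over D \<subseteq> crossing_params (curve D)"
    and card_over_under: "card (over D) = card (under D)"
begin

lemma crossing_params_eq: "crossing_params (curve D) = over D \<union> under D"
  using over_sub by (auto simp: under_def)

lemma disj: "x \<in> over D \<Longrightarrow> x \<in> under D \<Longrightarrow> False"
  by (auto simp: under_def)

sublocale ov: periodic_set "over D"
  using over_fin over_ne over_sub by unfold_locales (auto simp: crossing_params_def)

sublocale un: periodic_set "under D"
  using under_fin under_ne by unfold_locales (auto simp: under_def crossing_params_def)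

sublocale cr: periodic_set "crossing_params (curve D)"
  using over_fin over_ne under_fin
  by unfold_locales
    (auto simp: crossing_params_eq, auto simp: under_def crossing_params_def dest: subsetD[OF ov.sub])

text \<open>Cut the diagram just before the first overcrossing and just before the first undercrossing of
  each run; the resulting sequence closes up because it is strictly increasing and cannot skip a
  translate of its starting point.\<close>

lemma bridge_decomposition_exists: "\<exists>k. bridge_decomposition D k"
proof -
  obtain \<delta> where \<delta>: "\<delta> > 0"
    "\<And>x y. frac x \<in> crossing_params (curve D) \<Longrightarrow> frac y \<in> crossing_params (curve D) \<Longrightarrow>
       x < y \<Longrightarrow> x + \<delta> < y"
    using cr.gap by blast
  \<comment> \<open>Since \<open>v\<close> is an undercrossing, \<open>a 0\<close> opens a run of
    overcrossings. Then \<open>nu (a i)\<close> opens the run of undercrossings that follows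
    \<open>a i\<close>, and \<open>a (Suc i)\<close> the next run of overcrossings.\<close>
  define nu where "nu = next_in (under D)"
  define no where "no = next_in (over D)"
  define v where "v = nu 0"
  define a where "a i = ((no \<circ> nu) ^^ i) (no v)" for i
  have a0: "a 0 = no v" and aS: "a (Suc i) = no (nu (a i))" for i
    by (auto simp: a_def)
  have fa: "frac (a i) \<in> over D" for i
    by (cases i) (auto simp: a0 aS no_def ov.frac_next_in)
  have fu: "frac (nu x) \<in> under D" for x
    by (simp add: nu_def un.frac_next_in)
  have au: "a i < nu (a i)" and ua: "nu (a i) < a (Suc i)" for i
    using un.next_in_greater ov.next_in_greater by (auto simp: nu_def no_def aS)
  have au': "a i + \<delta> < nu (a i)" and ua': "nu (a i) + \<delta> < a (Suc i)" for i
    using \<delta>(2)[OF _ _ au[of i]] \<delta>(2)[OF _ _ ua[of i]] fa fu by (auto simp: crossing_params_eq)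
  have grow: "a 0 + real i * \<delta> \<le> a i" for i
  proof (induction i)
    case (Suc i)
    then show ?case using au'[of i] ua[of i] by (simp add: algebra_simps)
  qed simp
  have "\<exists>k. a (Suc k) = a 0 + 1"
  proof (rule ccontr)
    assume contra: "\<not> (\<exists>k. a (Suc k) = a 0 + 1)"
    \<comment> \<open>One turn later the sequence must hit \<open>a 0 + 1\<close>, the first
      overcrossing after the undercrossing \<open>v + 1\<close>. If \<open>a i\<close> is below
      \<open>a 0 + 1\<close>, it is below \<open>v + 1\<close> too, so \<open>nu (a i)\<close> is at
      most \<open>v + 1\<close> and \<open>a (Suc i)\<close> at most \<open>a 0 + 1\<close>;
      equality is excluded by \<open>contra\<close>.\<close>
    have below: "a i < a 0 + 1" for i
    proof (induction i)
      case (Suc i)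
      have a01: "a 0 + 1 = no (v + 1)"
        using ov.next_in_add_of_int[of v 1] by (simp add: a0 no_def)
      have "frac (v + 1) \<in> under D"
        using fu[of 0] frac_add_of_int[of v 1] by (simp add: v_def)
      moreover have "a i < v + 1"
      proof (rule ccontr)
        assume "\<not> a i < v + 1"
        moreover have "a i \<noteq> v + 1" using fa[of i] calculation disj \<open>frac (v + 1) \<in> under D\<close> by auto
        ultimately have "no (v + 1) \<le> a i"
          unfolding no_def using fa by (intro ov.next_in_le) auto
        with Suc a01 show False by simp
      qed
      ultimately have "nu (a i) \<le> v + 1"
        unfolding nu_def by (intro un.next_in_le)
      then have "nu (a i) < a 0 + 1"
        using a01 ov.next_in_greater[of "v + 1"] by (simp add: no_def)
      then have "a (Suc i) \<le> a 0 + 1"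
        unfolding aS no_def using fa[of 0] frac_add_of_int[of "a 0" 1] by (intro ov.next_in_le) auto
      then show ?case using contra by (simp add: less_le)
    qed simp
    \<comment> \<open>Steps of size at least \<open>\<delta>\<close> cannot stay below a
      bound.\<close>
    obtain n where "real n * \<delta> > 1" using \<delta>(1) reals_Archimedean3 by blast
    with grow[of n] below[of n] show False by linarith
  qed
  then obtain k where k: "k \<ge> 1" "a k = a 0 + 1" by (metis le_add1 plus_1_eq_Suc)
  \<comment> \<open>Distinct crossings are more than \<open>\<delta>\<close> apart, so moving back
    by \<open>\<delta>\<close> neither lands on a crossing nor jumps over one.\<close>
  have shift: "frac (x - \<delta>) \<notin> crossing_params (curve D)"
    if "frac x \<in> crossing_params (curve D)" for x
    using \<delta>(2)[of "x - \<delta>" x] that \<delta>(1) by auto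
  have ge: "x \<le> y" if "x - \<delta> \<le> y" "frac x \<in> crossing_params (curve D)"
    "frac y \<in> crossing_params (curve D)" for x y
    using \<delta>(2)[of y x] that by linarith
  have op: "overpass D (a i - \<delta>) (nu (a i) - \<delta>)" for i
  proof -
    have "a i \<in> {a i - \<delta>..nu (a i) - \<delta>}" using \<delta>(1) au'[of i] by auto
    then have "frac ` {a i - \<delta>..nu (a i) - \<delta>} \<inter> over D \<noteq> {}" using fa by blast
    moreover have "frac y \<notin> under D" if "a i - \<delta> \<le> y" "y \<le> nu (a i) - \<delta>" for y
    proof
      assume y: "frac y \<in> under D"
      then have "a i \<le> y" using ge[of "a i" y] fa that by (auto simp: crossing_params_eq)
      moreover have "a i \<noteq> y" using y fa disj by auto
      ultimately have "nu (a i) \<le> y" unfolding nu_def using y by (intro un.next_in_le) auto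
      with that \<delta>(1) show False by linarith
    qed
    ultimately show ?thesis unfolding overpass_def by auto
  qed
  have up: "underpass D (nu (a i) - \<delta>) (a (Suc i) - \<delta>)" for i
  proof -
    have "nu (a i) \<in> {nu (a i) - \<delta>..a (Suc i) - \<delta>}" using \<delta>(1) ua'[of i] by auto
    then have "frac ` {nu (a i) - \<delta>..a (Suc i) - \<delta>} \<inter> under D \<noteq> {}" using fu by blast
    moreover have "frac y \<notin> over D" if "nu (a i) - \<delta> \<le> y" "y \<le> a (Suc i) - \<delta>" for y
    proof
      assume y: "frac y \<in> over D"
      then have "nu (a i) \<le> y" using ge[of "nu (a i)" y] fu that by (auto simp: crossing_params_eq)
      moreover have "nu (a i) \<noteq> y" using y fu disj by auto
      ultimately have "a (Suc i) \<le> y" unfolding aS no_def using y by (intro ov.next_in_le) auto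
      with that \<delta>(1) show False by linarith
    qed
    ultimately show ?thesis unfolding underpass_def by auto
  qed
  have "bridge_decomposition D k"
    unfolding bridge_decomposition_def
    using k op up au ua shift fa fu
    by (intro conjI exI[of _ "\<lambda>i. a i - \<delta>"] exI[of _ "\<lambda>i. nu (a i) - \<delta>"])
      (auto simp: crossing_params_eq)
  then show ?thesis ..
qed

text \<open>\<open>nu\<close> is constant on each overpass, with value in the underpass right after
  it, and every overcrossing lies on some overpass. The resulting number depends on \<open>D\<close>
  alone, so this also gives uniqueness of \<open>k\<close>.\<close>

lemma bridge_decomposition_card:
  assumes "bridge_decomposition D k"
  shows "k = card ((\<lambda>x. frac (next_in (under D) x)) ` over D)"
proof -
  obtain s f where k: "k \<ge> 1" and sk: "s k = s 0 + 1"
    and sf: "\<And>i. i < k \<Longrightarrow> s i < f i" and fs: "\<And>i. i < k \<Longrightarrow> f i < s (Suc i)"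
    and op: "\<And>i. i < k \<Longrightarrow> overpass D (s i) (f i)"
    and up: "\<And>i. i < k \<Longrightarrow> underpass D (f i) (s (Suc i))"
    using assms unfolding bridge_decomposition_def by blast
  define nu where "nu = next_in (under D)"
  have no_under: "frac y \<notin> under D" if "i < k" "s i \<le> y" "y \<le> f i" for i y
    using op[OF that(1)] that unfolding overpass_def by (metis atLeastAtMost_iff disjoint_iff imageI)
  have no_over: "frac y \<notin> over D" if "i < k" "f i \<le> y" "y \<le> s (Suc i)" for i y
    using up[OF that(1)] that unfolding underpass_def by (metis atLeastAtMost_iff disjoint_iff imageI)
  have nu_eq: "nu y = nu (s i)" if "i < k" "s i \<le> y" "y \<le> f i" for i y
    unfolding nu_def using that no_under[OF that(1)] by (intro un.next_in_eq[symmetric]) auto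
  have nu_gt: "s i < nu (s i)" for i
    unfolding nu_def by (rule un.next_in_greater)
  have nu_lt: "nu (s i) < s (Suc i)" if i: "i < k" for i
  proof -
    obtain y where y: "f i \<le> y" "y \<le> s (Suc i)" "frac y \<in> under D"
      using up[OF i] by (auto simp: underpass_def)
    have "nu (s i) \<le> y"
      unfolding nu_def using y sf[OF i] by (intro un.next_in_le) auto
    \<comment> \<open>The endpoint \<open>s (Suc i)\<close> also belongs to the next overpass, which
      has no undercrossing. For the last index that overpass is the one at \<open>s 0\<close>,
      translated by one turn.\<close>
    moreover have "y \<noteq> s (Suc i)"
    proof
      assume "y = s (Suc i)"
      moreover have "frac (s (Suc i)) \<notin> under D"
      proof (cases "Suc i < k")
        case True
        then show ?thesis using no_under[of "Suc i" "s (Suc i)"] sf[of "Suc i"] by auto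
      next
        case False
        then have "Suc i = k" using i by simp
        then show ?thesis
          using no_under[of 0 "s 0"] sf[of 0] k sk frac_add_of_int[of "s 0" 1] by auto
      qed
      ultimately show False using y by simp
    qed
    ultimately show ?thesis using y by linarith
  qed
  have s_mono: "s i \<le> s j" if "i \<le> j" "j \<le> k" for i j
    using that
  proof (induction j rule: dec_induct)
    case (step j)
    then show ?case using sf[of j] fs[of j] by force
  qed simp
  have inj: "inj_on (\<lambda>i. frac (nu (s i))) {..<k}"
  proof (rule linorder_inj_onI)
    fix i j assume ij: "i < j" "i \<in> {..<k}" "j \<in> {..<k}"
    \<comment> \<open>The lifted values increase with the index and all lie strictly between
      \<open>s 0\<close> and \<open>s 0 + 1\<close>, so \<open>frac\<close> keeps them
      distinct.\<close>
    have "nu (s i) < nu (s j)"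
      using nu_lt[of i] s_mono[of "Suc i" j] nu_gt[of j] ij by auto
    moreover have "s 0 < nu (s i)" using s_mono[of 0 i] nu_gt[of i] ij by auto
    moreover have "nu (s j) < s 0 + 1" using s_mono[of "Suc j" k] nu_lt[of j] ij sk by auto
    ultimately show "frac (nu (s i)) \<noteq> frac (nu (s j))"
      using frac_inj_of_less_1[of "nu (s i)" "nu (s j)"] by auto
  qed auto
  have locate: "\<exists>i<k. s i \<le> x \<and> x < s (Suc i)" if x: "s 0 \<le> x" "x < s 0 + 1" for x
  proof -
    define j where "j = (LEAST j. x < s j)"
    have ex: "x < s k" using x sk by simp
    have j: "x < s j" "j \<le> k" unfolding j_def using ex by (auto intro: LeastI Least_le)
    then obtain i where i: "j = Suc i" using x by (cases j) auto
    then have "\<not> x < s i" using not_less_Least[of i "\<lambda>j. x < s j"] by (simp add: j_def)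
    with i j show ?thesis by (intro exI[of _ i]) auto
  qed
  have "(\<lambda>i. frac (nu (s i))) ` {..<k} = (\<lambda>x. frac (nu x)) ` over D"
  proof (intro equalityI image_subsetI)
    fix i assume "i \<in> {..<k}"
    then have i: "i < k" by simp
    then obtain y where y: "s i \<le> y" "y \<le> f i" "frac y \<in> over D"
      using op[OF i] by (auto simp: overpass_def)
    then have "frac (nu (s i)) = frac (nu (frac y))"
      using nu_eq[OF i y(1,2)] un.next_in_frac[of y] by (simp add: nu_def)
    with y show "frac (nu (s i)) \<in> (\<lambda>x. frac (nu x)) ` over D" by blast
  next
    fix x assume x: "x \<in> over D"
    \<comment> \<open>The translate of \<open>x\<close> in the turn that starts at
      \<open>s 0\<close>. Being an overcrossing, it avoids the underpasses and so falls on an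
      overpass.\<close>
    define y where "y = x + of_int (- \<lfloor>x - s 0\<rfloor>)"
    have "s 0 \<le> y" "y < s 0 + 1" unfolding y_def by linarith+
    then obtain i where i: "i < k" "s i \<le> y" "y < s (Suc i)" using locate by blast
    have "frac x = x" using x ov.sub by (auto simp: frac_eq)
    then have "frac y \<in> over D" using x unfolding y_def frac_add_of_int by simp
    then have "y \<le> f i" using no_over[OF i(1), of y] i by force
    then have "nu (s i) = nu y" using nu_eq[OF i(1,2)] by simp
    also have "\<dots> = nu x + of_int (- \<lfloor>x - s 0\<rfloor>)"
      unfolding y_def nu_def un.next_in_add_of_int ..
    finally have "frac (nu x) = frac (nu (s i))" by (simp only: frac_add_of_int)
    with i show "frac (nu x) \<in> (\<lambda>i. frac (nu (s i))) ` {..<k}" by auto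
  qed
  then show ?thesis using card_image[OF inj] by (simp add: nu_def)
qed

lemma the_bridge_decomposition:
  "(THE k. bridge_decomposition D k) = card ((\<lambda>x. frac (next_in (under D) x)) ` over D)"
  using bridge_decomposition_exists bridge_decomposition_card by (metis the_equality)

text \<open>A failure of injectivity yields two overcrossings in a row. Conversely, two
  overcrossings in a row have the same image, while two undercrossings in a row leave the second one
  outside the image, which equal cardinalities forbid.\<close>

lemma alternating_iff_inj_on:
  "alternating D \<longleftrightarrow> inj_on (\<lambda>x. frac (next_in (under D) x)) (over D)"
proof
  assume alt: "alternating D"
  have no_lt: False
    if "frac x \<in> over D" "frac y \<in> over D" "x < y" "next_in (under D) x = next_in (under D) y" for x y
  proof -
    \<comment> \<open>The overcrossing \<open>y\<close> need not be adjacent to \<open>x\<close>,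
      but the next overcrossing \<open>t\<close> after \<open>x\<close> is: no undercrossing occurs
      before \<open>y\<close>.\<close>
    define t where "t = next_in (over D) x"
    have "t \<le> y" unfolding t_def using that by (intro ov.next_in_le)
    then have "t < next_in (under D) x" using that un.next_in_greater[of y] by simp
    then have "frac z \<notin> crossing_params (curve D)" if "x < z" "z < t" for z
      using that ov.next_in_le[of x z] un.next_in_le[of x z]
      by (auto simp: crossing_params_eq t_def)
    moreover have t: "frac t \<in> over D" "x < t"
      unfolding t_def by (rule ov.frac_next_in ov.next_in_greater)+
    ultimately have "frac t \<in> under D"
      using alt[unfolded alternating_def, rule_format, of x t] that(1) over_sub by blast
    with t(1) show False by (rule disj)
  qed
  show "inj_on (\<lambda>x. frac (next_in (under D) x)) (over D)"
  proof (rule inj_onI)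
    fix x y assume xy: "x \<in> over D" "y \<in> over D"
      "frac (next_in (under D) x) = frac (next_in (under D) y)"
    then obtain m where "next_in (under D) x = next_in (under D) y + of_int m"
      unfolding frac_eq_iff_diff_Ints by blast
    \<comment> \<open>Equality modulo 1 becomes equality on the line once \<open>y\<close> is
      replaced by a translate.\<close>
    then have eq: "next_in (under D) x = next_in (under D) (y + of_int m)"
      by (simp add: un.next_in_add_of_int)
    have fr: "frac x = x" "frac y = y" using xy ov.sub by (auto simp: frac_eq)
    have "x = y + of_int m"
      using no_lt[of x "y + of_int m"] no_lt[of "y + of_int m" x] eq xy fr
      by (metis frac_add_of_int linorder_neqE_linordered_idom)
    then show "x = y" using fr by (metis frac_add_of_int)
  qed
next
  assume inj: "inj_on (\<lambda>x. frac (next_in (under D) x)) (over D)"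
  have img: "(\<lambda>x. frac (next_in (under D) x)) ` over D = under D"
    using card_image[OF inj] card_over_under un.frac_next_in
    by (intro card_subset_eq[OF under_fin]) auto
  show "alternating D"
    unfolding alternating_def
  proof (intro allI impI, elim conjE)
    fix s t
    assume st: "s < t" "frac s \<in> crossing_params (curve D)" "frac t \<in> crossing_params (curve D)"
      and btw: "\<forall>u. s < u \<and> u < t \<longrightarrow> frac u \<notin> crossing_params (curve D)"
    have "frac t \<notin> over D" if s: "frac s \<in> over D"
    proof
      assume t: "frac t \<in> over D"
      have "frac z \<notin> under D" if "s < z" "z \<le> t" for z
        using that btw t disj by (cases "z = t") (auto simp: crossing_params_eq)
      then have "next_in (under D) s = next_in (under D) t"
        using st(1) by (intro un.next_in_eq) auto
      then have "frac (next_in (under D) (frac s)) = frac (next_in (under D) (frac t))"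
        by (simp add: un.next_in_frac)
      \<comment> \<open>Injectivity only identifies \<open>s\<close> and \<open>t\<close> modulo 1.
        The remaining case is at least a full turn without crossings in between, but every full turn
        contains an undercrossing.\<close>
      then have "frac t = frac s" using inj s t by (auto dest: inj_onD)
      then obtain m :: int where "t = s + of_int m"
        unfolding frac_eq_iff_diff_Ints by blast
      then have "s + 1 \<le> t" using st by simp
      moreover have "next_in (under D) s \<noteq> t"
        using un.frac_next_in[of s] t disj by auto
      ultimately have "next_in (under D) s < t"
        using un.next_in_le_add_1[of s] by linarith
      with btw un.next_in_greater[of s] un.frac_next_in[of s] show False
        by (auto simp: crossing_params_eq)
    qed
    moreover have "frac t \<notin> under D" if s: "frac s \<in> under D"
    proof
      assume "frac t \<in> under D"
      then obtain p where p: "p \<in> over D" "frac t = frac (next_in (under D) p)"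
        using img by auto
      then obtain m where m: "t = next_in (under D) p + of_int m"
        unfolding frac_eq_iff_diff_Ints by blast
      \<comment> \<open>\<open>q\<close> is an overcrossing whose next undercrossing is
        \<open>t\<close>. It cannot lie from \<open>s\<close> up to \<open>t\<close>, so it precedes
        \<open>s\<close>; but then \<open>s\<close> is an earlier undercrossing after
        \<open>q\<close>.\<close>
      define q where "q = p + of_int m"
      have t: "t = next_in (under D) q" by (simp add: q_def m un.next_in_add_of_int)
      have q: "frac q \<in> over D"
        using p ov.sub frac_eq[of p] unfolding q_def by (auto simp: subset_iff)
      have "q < t" unfolding t by (rule un.next_in_greater)
      then have "q < s"
        using btw q s disj by (cases q s rule: linorder_cases) (auto simp: crossing_params_eq)
      then have "t \<le> s" unfolding t using s by (intro un.next_in_le)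
      with st show False by simp
    qed
    ultimately show "frac s \<in> over D \<longleftrightarrow> frac t \<in> under D"
      using st by (auto simp: crossing_params_eq)
  qed
qed

end

subsection \<open>Knot diagrams\<close>

lemma knot_diagramE:
  assumes "knot_diagram D"
  obtains g where "projects_to g D"
    "\<And>s t. s \<in> {0..<1} \<Longrightarrow> t \<in> {0..<1} \<Longrightarrow> s \<noteq> t \<Longrightarrow> g s \<noteq> g t"
proof -
  obtain K g where K: "knot K" "stereo \<circ> g \<in> K" "projects_to g D"
    using assms by (auto simp: knot_diagram_def diagram_of_def)
  \<comment> \<open>The isotopy relation is restricted to \<open>tame_circles\<close>, so every
    member of a class is a tame circle.\<close>
  have "stereo \<circ> g \<in> tame_circles"
    using K(1,2) by (auto simp: knot_def quotient_def)
  then have simple: "simple_path (stereo \<circ> g)"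
    by (simp add: tame_circles_def embedded_circle_def)
  have "g s \<noteq> g t" if "s \<in> {0..<1}" "t \<in> {0..<1}" "s \<noteq> t" for s t
  proof
    assume "g s = g t"
    moreover have "s \<in> {0..1}" "t \<in> {0..1}" using that by auto
    ultimately have "s = t \<or> s = 0 \<and> t = 1 \<or> s = 1 \<and> t = 0"
      using simple unfolding simple_path_def loop_free_def by (metis comp_apply)
    with that show False by auto
  qed
  with K(3) show ?thesis by (rule that)
qed

text \<open>Over each double point lie exactly two parameters. They have the same projection, so
  injectivity of \<open>g\<close> forces different heights: the higher one is the overcrossing, the
  lower one the undercrossing.\<close>

lemma knot_diagram_bij_betw:
  assumes "knot_diagram D"
  shows "finite (crossings (curve D))"
    and "over D \<subseteq> crossing_params (curve D)"
    and "bij_betw (curve D) (over D) (crossings (curve D))"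
    and "bij_betw (curve D) (under D) (crossings (curve D))"
proof -
  obtain g where g: "projects_to g D"
    and inj: "\<And>s t. s \<in> {0..<1} \<Longrightarrow> t \<in> {0..<1} \<Longrightarrow> s \<noteq> t \<Longrightarrow> g s \<noteq> g t"
    using knot_diagramE[OF assms] by blast
  let ?\<gamma> = "curve D"
  have reg: "regular ?\<gamma>" and proj: "\<And>t. t \<in> {0..1} \<Longrightarrow> ?\<gamma> t = fst (g t)"
    and ov: "over D =
      {s \<in> {0..<1}. \<exists>t\<in>{0..<1}. s \<noteq> t \<and> ?\<gamma> s = ?\<gamma> t \<and> snd (g t) < snd (g s)}"
    using g by (auto simp: projects_to_def)
  show fin: "finite (crossings ?\<gamma>)" using reg by (simp add: regular_def)
  show sub: "over D \<subseteq> crossing_params ?\<gamma>"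
    unfolding ov crossing_params_def crossings_def by force
  have height: "snd (g s) \<noteq> snd (g t)"
    if "s \<in> {0..<1}" "t \<in> {0..<1}" "s \<noteq> t" "?\<gamma> s = ?\<gamma> t" for s t
    using that inj[of s t] proj[of s] proj[of t] by (auto simp: prod_eq_iff)
  have split: "\<exists>s t. s \<in> over D \<and> t \<in> under D \<and> {u \<in> {0..<1}. ?\<gamma> u = P} = {s, t}"
    if P: "P \<in> crossings ?\<gamma>" for P
  proof -
    have "card {u \<in> {0..<1}. ?\<gamma> u = P} = 2" using reg P by (simp add: regular_def)
    then obtain s t where st: "{u \<in> {0..<1}. ?\<gamma> u = P} = {s, t}" "s \<noteq> t"
      by (auto simp: card_2_iff)
    have *: "a \<in> over D \<and> b \<in> under D"
      if ab: "{u \<in> {0..<1}. ?\<gamma> u = P} = {a, b}" "a \<noteq> b" "snd (g b) < snd (g a)" for a b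
    proof -
      have mem: "a \<in> {0..<1}" "b \<in> {0..<1}" "?\<gamma> a = P" "?\<gamma> b = P" using ab(1) by blast+
      then have "a \<in> over D" using ab by (auto simp: ov)
      moreover have "b \<notin> over D"
      proof
        assume "b \<in> over D"
        then obtain u where "u \<in> {0..<1}" "u \<noteq> b" "?\<gamma> u = P" "snd (g u) < snd (g b)"
          using mem by (auto simp: ov)
        moreover from this have "u = a" using ab(1) by blast
        ultimately show False using ab(3) by simp
      qed
      ultimately show ?thesis using mem P by (simp add: under_def crossing_params_def)
    qed
    have mem: "s \<in> {0..<1}" "t \<in> {0..<1}" "?\<gamma> s = P" "?\<gamma> t = P" using st(1) by blast+
    then have "snd (g s) \<noteq> snd (g t)" using height st by simp
    then consider "snd (g t) < snd (g s)" | "snd (g s) < snd (g t)" by linarith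
    then show ?thesis
    proof cases
      case 1
      then show ?thesis using *[of s t] st by blast
    next
      case 2
      then show ?thesis using *[of t s] st by (metis insert_commute)
    qed
  qed
  \<comment> \<open>Common to both kinds: a set of crossing parameters that contains exactly one of
    the two points of each fibre is in bijection with the crossings.\<close>
  have bij: "bij_betw ?\<gamma> A (crossings ?\<gamma>)"
    if A: "A \<subseteq> crossing_params ?\<gamma>"
      and one: "\<And>P. P \<in> crossings ?\<gamma> \<Longrightarrow> \<exists>a b. a \<in> A \<and> b \<notin> A \<and> {u \<in> {0..<1}. ?\<gamma> u = P} = {a, b}"
    for A
  proof (rule bij_betw_imageI)
    show "inj_on ?\<gamma> A"
    proof (rule inj_onI)
      fix x y assume xy: "x \<in> A" "y \<in> A" "?\<gamma> x = ?\<gamma> y"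
      then have "?\<gamma> x \<in> crossings ?\<gamma>" and m: "x \<in> {0..<1}" "y \<in> {0..<1}"
        using A by (auto simp: crossing_params_def)
      then obtain a b where ab: "a \<in> A" "b \<notin> A" "{u \<in> {0..<1}. ?\<gamma> u = ?\<gamma> x} = {a, b}"
        using one by blast
      have "x \<in> {a, b}" "y \<in> {a, b}" using ab(3) m xy by auto
      then show "x = y" using ab xy by auto
    qed
    show "?\<gamma> ` A = crossings ?\<gamma>"
    proof
      show "?\<gamma> ` A \<subseteq> crossings ?\<gamma>" using A by (auto simp: crossing_params_def)
      show "crossings ?\<gamma> \<subseteq> ?\<gamma> ` A"
      proof
        fix P assume "P \<in> crossings ?\<gamma>"
        from one[OF this] obtain a b where "a \<in> A" "{u \<in> {0..<1}. ?\<gamma> u = P} = {a, b}"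
          by blast
        moreover from this(2) have "?\<gamma> a = P" by blast
        ultimately show "P \<in> ?\<gamma> ` A" by blast
      qed
    qed
  qed
  have disj: "t \<notin> over D" if "t \<in> under D" for t using that by (simp add: under_def)
  show "bij_betw ?\<gamma> (over D) (crossings ?\<gamma>)"
  proof (rule bij[OF sub])
    fix P assume "P \<in> crossings ?\<gamma>"
    from split[OF this] disj
    show "\<exists>a b. a \<in> over D \<and> b \<notin> over D \<and> {u \<in> {0..<1}. ?\<gamma> u = P} = {a, b}"
      by metis
  qed
  show "bij_betw ?\<gamma> (under D) (crossings ?\<gamma>)"
  proof (rule bij)
    show "under D \<subseteq> crossing_params ?\<gamma>" by (simp add: under_def)
    fix P assume "P \<in> crossings ?\<gamma>"
    from split[OF this] disj
    show "\<exists>a b. a \<in> under D \<and> b \<notin> under D \<and> {u \<in> {0..<1}. ?\<gamma> u = P} = {a, b}"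
      by (metis insert_commute)
  qed
qed

lemma knot_diagram_bridge_le_crossing:
  assumes "knot_diagram D"
  shows "b_diagram D \<le> c_diagram D \<and> (b_diagram D = c_diagram D \<longleftrightarrow> alternating D)"
proof (cases "c_diagram D = 0")
  case True
  \<comment> \<open>Without crossings \<open>b_diagram D\<close> is 0 by definition and alternation
    holds vacuously.\<close>
  then have "crossing_params (curve D) = {}"
    using knot_diagram_bij_betw(1)[OF assms] by (simp add: c_diagram_def crossing_params_def)
  then show ?thesis using True by (simp add: b_diagram_def alternating_def)
next
  case False
  note * = knot_diagram_bij_betw[OF assms]
  have card: "card (over D) = c_diagram D" "card (under D) = c_diagram D"
    using bij_betw_same_card[OF *(3)] bij_betw_same_card[OF *(4)] by (auto simp: c_diagram_def)
  interpret crossing_diagram D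
    using * card False bij_betw_finite[OF *(3)] bij_betw_finite[OF *(4)]
    by unfold_locales auto
  have b: "b_diagram D = card ((\<lambda>x. frac (next_in (under D) x)) ` over D)"
    using False by (simp add: b_diagram_def the_bridge_decomposition)
  show ?thesis
    \<comment> \<open>On a finite set, injectivity means that the image has full cardinality, here
      \<open>c_diagram D\<close>.\<close>
    unfolding b alternating_iff_inj_on inj_on_iff_eq_card[OF over_fin] card(1)
    using card_image_le[OF over_fin] card(1) by metis
qed

lemma b_knot_le_c_knot:
  assumes "knot K"
  shows "b_knot K \<le> c_knot K"
\<comment> \<open>A diagram attaining \<open>c_knot K\<close> bounds \<open>b_knot K\<close>. If
  there were no diagram, both sides would be the same value \<open>Inf {}\<close>.\<close>
proof (cases "\<exists>D. diagram_of D K")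
  case True
  then have "c_knot K \<in> {c_diagram D |D. diagram_of D K}"
    unfolding c_knot_def by (intro Inf_nat_def1) auto
  then obtain D where D: "c_knot K = c_diagram D" "diagram_of D K" by blast
  have "b_knot K \<le> b_diagram D"
    unfolding b_knot_def using D by (intro cInf_lower) auto
  also have "\<dots> \<le> c_diagram D"
    using knot_diagram_bridge_le_crossing assms D by (auto simp: knot_diagram_def)
  finally show ?thesis using D by simp
qed (simp add: b_knot_def c_knot_def)

theorem lemma2p4:
  "(\<forall>D. knot_diagram D \<longrightarrow>
      b_diagram D \<le> c_diagram D \<and> (b_diagram D = c_diagram D \<longleftrightarrow> alternating D)) \<and>
   (\<forall>K. knot K \<longrightarrow> b_knot K \<le> c_knot K)"
  using knot_diagram_bridge_le_crossing b_knot_le_c_knot by blast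

end
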